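(* Let $L$ be the generator of a Markov process on $E$ with invariant probability measure $\mu$ and carré du champ $\Gamma$. Assume that there exists a Lyapunov function $V$: $V\in D(L)$, $V\ge1$, $\int V\,d\mu<+\infty$, and $LV\le-2\alpha V+b\,\mathbf 1_C$ for some constants $\alpha>0$, $b>0$ and some set $C$ (not necessarily petite). Assume that there is a set $U\subset E$ such that $\mu$ satisfies a local Poincaré inequality on $U$ with constant $\kappa_U$. Assume in addition that (1) either $U\supseteq C'=C\cap\{V\le b/\alpha\}$ and $\alpha\,\mu(U)>b\,\mu(U^c)$, (2) or $U\supseteq\{V\le b/\alpha\}$ and $\mu(U)>\mu(U^c)$. Then one can find some $\lambda\ge0$ such that, with $W=V+\lambda$, $\mu$ satisfies a $(W)$-Lyapunov-Poincaré inequality: there is a constant $C_{LP}$ such that for all nice $f$ with $\int f\,d\mu=0$, $$\int f^2\,W\,d\mu\le C_{LP}\int\left(W\,\Gamma(f)-f^2\,LW\right)d\mu.$$ More precisely, one can choose $\lambda=(b\,\kappa_U-1)_+$ in both cases, together with $$\frac1{C_{LP}}=\frac{\alpha}{1+\lambda}\left(1-\frac{b\,\mu(U^c)}{\alpha\,\mu(U)}\right)\ \text{ in case (1)},\qquad \frac1{C_{LP}}=\frac{\alpha}{1+\lambda}\left(1-\frac{\mu(U^c)}{\mu(U)}\right)\ \text{ in case (2)}.$$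
   Context: $\mu$ is an invariant probability measure for the Markov process with generator $L$ (with extended domain $D(L)$). Standing assumption: there is an algebra of functions which is a core for $L$ ("nice" functions are functions in this algebra, regular enough for the expressions to make sense) and on which $L(fg)=fLg+gLf+\Gamma(f,g)$ and $\Gamma(fg,h)=f\Gamma(g,h)+g\Gamma(f,h)$; $\Gamma(f)=\Gamma(f,f)$. Local Poincaré inequality on $U\subset E$ with constant $\kappa_U$: for all nice $f$ with $\int_Ef\,d\mu=0$, $$\int_Uf^2\,d\mu\le\kappa_U\int_E\Gamma(f)\,d\mu+\frac1{\mu(U)}\left(\int_Uf\,d\mu\right)^2$$ (the energy integral is over the whole space $E$). Here $x_+=\max(x,0)$. *)

theory Defs
  imports "HOL-Probability.Probability"
begin

section \<open>Continuous-time Markov processes\<close>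

text \<open>
  A process on a measurable space \<open>states\<close>, realised on a measurable space \<open>sample\<close> and carrying
  one law per starting point. Only the \<open>\<sigma>\<close>-algebras of \<open>states\<close>, \<open>sample\<close> and \<open>filt t\<close> matter,
  and only times \<open>t \<ge> 0\<close> are meaningful (for \<open>t < 0\<close> one may put \<open>filt t = filt 0\<close>).
\<close>

record ('e, 'w) process =
  states :: "'e measure"
  sample :: "'w measure"
  filt :: "real \<Rightarrow> 'w measure"
  traj :: "real \<Rightarrow> 'w \<Rightarrow> 'e"
  law :: "'e \<Rightarrow> 'w measure"

definition transition :: "('e, 'w) process \<Rightarrow> real \<Rightarrow> 'e \<Rightarrow> 'e measure" where
  "transition X t x = distr (law X x) (states X) (traj X t)"

text \<open>
  Progressive measurability makes the time integrals of functions of the trajectory adapted; it is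
  automatic for adapted right-continuous trajectories in a metrizable space.
\<close>

locale markov_process =
  fixes X :: "('e, 'w) process"
  assumes law_kernel: "law X \<in> states X \<rightarrow>\<^sub>M prob_algebra (sample X)"
    and filtration_filt: "filtration (space (sample X)) (filt X)"
    and sets_filt: "\<And>t. sets (filt X t) \<subseteq> sets (sample X)"
    and progressive: "\<And>t. t \<ge> 0 \<Longrightarrow>
      (\<lambda>(s, \<omega>). traj X s \<omega>) \<in> restrict_space borel {0..t} \<Otimes>\<^sub>M filt X t \<rightarrow>\<^sub>M states X"
    and start: "\<And>x. x \<in> space (states X) \<Longrightarrow> transition X 0 x = return (states X) x"
    and markov: "\<And>x s t B. x \<in> space (states X) \<Longrightarrow> s \<ge> 0 \<Longrightarrow> t \<ge> 0 \<Longrightarrow> B \<in> sets (states X) \<Longrightarrow>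
      AE \<omega> in law X x.
        real_cond_exp (law X x) (filt X s) (\<lambda>\<omega>'. indicator B (traj X (s + t) \<omega>')) \<omega>
          = measure (transition X t (traj X s \<omega>)) B"

definition invariant_probability :: "('e, 'w) process \<Rightarrow> 'e measure \<Rightarrow> bool" where
  "invariant_probability X \<mu> \<longleftrightarrow>
     prob_space \<mu> \<and> sets \<mu> = sets (states X) \<and> (\<forall>t\<ge>0. \<mu> \<bind> transition X t = \<mu>)"

section \<open>The extended generator\<close>

definition martingale :: "'w measure \<Rightarrow> (real \<Rightarrow> 'w measure) \<Rightarrow> (real \<Rightarrow> 'w \<Rightarrow> real) \<Rightarrow> bool" where
  "martingale P F M \<longleftrightarrow>
     (\<forall>t\<ge>0. M t \<in> borel_measurable (F t) \<and> integrable P (M t)) \<and>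
     (\<forall>s\<ge>0. \<forall>t\<ge>s. AE \<omega> in P. real_cond_exp P (F s) (M t) \<omega> = M s \<omega>)"

text \<open>
  The localizing times may be taken real-valued: if \<open>T n\<close> localizes, then so does \<open>min (T n) n\<close>.
\<close>

definition local_martingale :: "'w measure \<Rightarrow> (real \<Rightarrow> 'w measure) \<Rightarrow> (real \<Rightarrow> 'w \<Rightarrow> real) \<Rightarrow> bool" where
  "local_martingale P F M \<longleftrightarrow>
     (\<forall>t\<ge>0. M t \<in> borel_measurable (F t)) \<and>
     (AE \<omega> in P. \<forall>t\<ge>0. continuous (at_right t) (\<lambda>s. M s \<omega>)) \<and>
     (\<exists>T :: nat \<Rightarrow> 'w \<Rightarrow> real.
        (\<forall>n. stopping_time F (T n) \<and> (\<forall>\<omega>\<in>space P. 0 \<le> T n \<omega>)) \<and>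
        (AE \<omega> in P. incseq (\<lambda>n. T n \<omega>) \<and> filterlim (\<lambda>n. T n \<omega>) at_top sequentially) \<and>
        (\<forall>n. martingale P F (\<lambda>t \<omega>. M (min t (T n \<omega>)) \<omega> - M 0 \<omega>)))"

text \<open>
  \<open>extended_generator X f g\<close> means that \<open>f\<close> belongs to the extended domain \<open>D(L)\<close> and that \<open>g\<close> is
  a version of \<open>L f\<close>. As usual \<open>L f\<close> is determined only up to a set of potential zero, hence up to
  a null set of any invariant probability measure, which is why it is a relation here.
\<close>

definition extended_generator :: "('e, 'w) process \<Rightarrow> ('e \<Rightarrow> real) \<Rightarrow> ('e \<Rightarrow> real) \<Rightarrow> bool" where
  "extended_generator X f g \<longleftrightarrow>
     f \<in> borel_measurable (states X) \<and> g \<in> borel_measurable (states X) \<and>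
     (\<forall>x\<in>space (states X).
        (AE \<omega> in law X x. \<forall>t\<ge>0. set_integrable lborel {0..t} (\<lambda>s. g (traj X s \<omega>))) \<and>
        local_martingale (law X x) (filt X)
          (\<lambda>t \<omega>. f (traj X t \<omega>) - f (traj X 0 \<omega>) - (LINT s:{0..t}|lborel. g (traj X s \<omega>))))"

section \<open>Nice functions and the carre du champ\<close>

definition square_integrable :: "'e measure \<Rightarrow> ('e \<Rightarrow> real) \<Rightarrow> bool" where
  "square_integrable \<mu> f \<longleftrightarrow> f \<in> borel_measurable \<mu> \<and> integrable \<mu> (\<lambda>x. (f x)\<^sup>2)"

text \<open>
  The generator of the semigroup in \<open>L\<^sup>2(\<mu>)\<close>: \<open>(P\<^sub>t f - f) / t\<close> tends to \<open>g\<close> in \<open>L\<^sup>2(\<mu>)\<close> as \<open>t\<close>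
  decreases to \<open>0\<close>.
\<close>

definition L2_generator :: "('e, 'w) process \<Rightarrow> 'e measure \<Rightarrow> ('e \<Rightarrow> real) \<Rightarrow> ('e \<Rightarrow> real) \<Rightarrow> bool" where
  "L2_generator X \<mu> f g \<longleftrightarrow>
     square_integrable \<mu> f \<and> square_integrable \<mu> g \<and>
     ((\<lambda>t. \<integral>\<^sup>+x. ennreal ((((\<integral>y. f y \<partial>transition X t x) - f x) / t - g x)\<^sup>2) \<partial>\<mu>) \<longlongrightarrow> 0) (at_right 0)"

text \<open>The normalisation is without the factor \<open>1/2\<close>.\<close>

definition carre_du_champ ::
  "(('e \<Rightarrow> real) \<Rightarrow> 'e \<Rightarrow> real) \<Rightarrow> ('e \<Rightarrow> real) \<Rightarrow> ('e \<Rightarrow> real) \<Rightarrow> 'e \<Rightarrow> real" where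
  "carre_du_champ L f g x = L (\<lambda>y. f y * g y) x - f x * L g x - g x * L f x"

text \<open>
  \<open>A\<close> is an algebra of functions, \<open>L\<close> the generator on \<open>A\<close> (for \<open>f \<in> A\<close>, the function \<open>L f\<close> is both
  a version of the extended generator and the \<open>L\<^sup>2(\<mu>)\<close> generator at \<open>f\<close>), and \<open>A\<close> is a core: the
  graph of \<open>L\<close> on \<open>A\<close> is dense in the graph of the \<open>L\<^sup>2(\<mu>)\<close> generator. The algebra need not contain
  the constants, so that compactly supported smooth functions are covered.
\<close>

locale core_algebra = markov_process X
  for X :: "('e, 'w) process" +
  fixes \<mu> :: "'e measure"
    and L :: "('e \<Rightarrow> real) \<Rightarrow> 'e \<Rightarrow> real"
    and A :: "('e \<Rightarrow> real) set"
  assumes invariant: "invariant_probability X \<mu>"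
    and nonempty: "A \<noteq> {}"
    and add_closed: "\<And>f g. f \<in> A \<Longrightarrow> g \<in> A \<Longrightarrow> (\<lambda>x. f x + g x) \<in> A"
    and scale_closed: "\<And>c f. f \<in> A \<Longrightarrow> (\<lambda>x. c * f x) \<in> A"
    and mult_closed: "\<And>f g. f \<in> A \<Longrightarrow> g \<in> A \<Longrightarrow> (\<lambda>x. f x * g x) \<in> A"
    and extended: "\<And>f. f \<in> A \<Longrightarrow> extended_generator X f (L f)"
    and in_L2_domain: "\<And>f. f \<in> A \<Longrightarrow> L2_generator X \<mu> f (L f)"
    and core: "\<And>f g \<epsilon>. L2_generator X \<mu> f g \<Longrightarrow> \<epsilon> > 0 \<Longrightarrow>
      \<exists>h\<in>A. (\<integral>x. (f x - h x)\<^sup>2 \<partial>\<mu>) + (\<integral>x. (g x - L h x)\<^sup>2 \<partial>\<mu>) < \<epsilon>"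
    and derivation: "\<And>f g h. f \<in> A \<Longrightarrow> g \<in> A \<Longrightarrow> h \<in> A \<Longrightarrow>
      AE x in \<mu>. carre_du_champ L (\<lambda>y. f y * g y) h x
        = f x * carre_du_champ L g h x + g x * carre_du_champ L f h x"

section \<open>Functional inequalities\<close>

definition local_poincare ::
  "'e measure \<Rightarrow> (('e \<Rightarrow> real) \<Rightarrow> 'e \<Rightarrow> real) \<Rightarrow> ('e \<Rightarrow> real) set \<Rightarrow> 'e set \<Rightarrow> real \<Rightarrow> bool" where
  "local_poincare \<mu> L A U \<kappa> \<longleftrightarrow>
     (\<forall>f\<in>A. (\<integral>x. f x \<partial>\<mu>) = 0 \<longrightarrow>
        (LINT x:U|\<mu>. (f x)\<^sup>2)
          \<le> \<kappa> * (\<integral>x. carre_du_champ L f f x \<partial>\<mu>) + 1 / measure \<mu> U * (LINT x:U|\<mu>. f x)\<^sup>2)"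

text \<open>
  \<open>LW\<close> is a version of \<open>L W\<close>. For \<open>f \<in> A\<close> the right-hand integral need not make sense, so \<open>f\<close> is
  required to be regular enough for that; the finiteness of the left-hand side is then part of
  the inequality.
\<close>

definition lyapunov_poincare ::
  "('e, 'w) process \<Rightarrow> 'e measure \<Rightarrow> (('e \<Rightarrow> real) \<Rightarrow> 'e \<Rightarrow> real) \<Rightarrow> ('e \<Rightarrow> real) set \<Rightarrow>
   ('e \<Rightarrow> real) \<Rightarrow> ('e \<Rightarrow> real) \<Rightarrow> real \<Rightarrow> bool" where
  "lyapunov_poincare X \<mu> L A W LW K \<longleftrightarrow>
     extended_generator X W LW \<and>
     (\<forall>f\<in>A. (\<integral>x. f x \<partial>\<mu>) = 0 \<longrightarrow>
        integrable \<mu> (\<lambda>x. W x * carre_du_champ L f f x - (f x)\<^sup>2 * LW x) \<longrightarrow>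
        integrable \<mu> (\<lambda>x. (f x)\<^sup>2 * W x) \<and>
        (\<integral>x. (f x)\<^sup>2 * W x \<partial>\<mu>)
          \<le> K * (\<integral>x. W x * carre_du_champ L f f x - (f x)\<^sup>2 * LW x \<partial>\<mu>))"

end

theory Submission
  imports Defs
begin

text \<open>
  Since \<open>V \<ge> 1\<close>, the drift condition gives \<open>-LV \<ge> \<alpha> V - b 1\<^sub>U\<close> pointwise: where \<open>V > b/\<alpha>\<close>
  half of the drift absorbs \<open>b\<close>, and the rest of \<open>C\<close> lies in \<open>U\<close>. The term \<open>b \<integral>\<^sub>U f\<^sup>2\<close> is
  controlled by the local Poincare inequality; its energy is absorbed by \<open>(1 + \<lambda>) \<integral> \<Gamma>(f)\<close>, and, as
  \<open>f\<close> is centred, its mean term equals \<open>b/\<mu>(U) (\<integral>\<^bsub>U\<^sup>c\<^esub> f)\<^sup>2\<close>, which Cauchy-Schwarz bounds by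
  \<open>b \<mu>(U\<^sup>c)/\<mu>(U) \<integral>\<^bsub>U\<^sup>c\<^esub> f\<^sup>2\<close>. This is absorbed by \<open>\<alpha> \<integral> V f\<^sup>2\<close>. Positivity of \<open>\<Gamma>(f)\<close> is not part of
  the setting and comes from Jensen's inequality for the transition kernels.
\<close>

section \<open>Square-integrable functions and Cauchy-Schwarz on a set\<close>

lemma square_integrable_mult_integrable:
  assumes "square_integrable M f" "square_integrable M g"
  shows "integrable M (\<lambda>x. f x * g x)"
proof (rule Bochner_Integration.integrable_bound)
  show "integrable M (\<lambda>x. (f x)\<^sup>2 + (g x)\<^sup>2)"
    using assms by (simp add: square_integrable_def)
  show "(\<lambda>x. f x * g x) \<in> borel_measurable M"
    using assms by (auto simp: square_integrable_def)
  have "\<bar>u * v\<bar> \<le> u\<^sup>2 + v\<^sup>2" for u v :: real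
  proof -
    have "0 \<le> (\<bar>u\<bar> - \<bar>v\<bar>)\<^sup>2" by simp
    also have "\<dots> = u\<^sup>2 + v\<^sup>2 - 2 * \<bar>u * v\<bar>"
      by (simp add: power2_diff abs_mult)
    finally show ?thesis by simp
  qed
  then show "AE x in M. norm (f x * g x) \<le> norm ((f x)\<^sup>2 + (g x)\<^sup>2)"
    by (auto simp: abs_mult)
qed

lemma (in finite_measure) square_integrable_integrable:
  assumes "square_integrable M f"
  shows "integrable M f"
  using square_integrable_mult_integrable[OF assms, of "\<lambda>_. 1"]
  by (simp add: square_integrable_def)

text \<open>The integral of \<open>(f x - t)\<^sup>2\<close> over \<open>B\<close> is a nonnegative
  quadratic polynomial in \<open>t\<close>; a good choice of \<open>t\<close> yields the
  inequality.\<close>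

lemma (in finite_measure) set_integral_Cauchy_Schwarz:
  fixes f :: "'a \<Rightarrow> real"
  assumes f: "square_integrable M f" and B: "B \<in> sets M"
  shows "(LINT x:B|M. f x)\<^sup>2 \<le> measure M B * (LINT x:B|M. (f x)\<^sup>2)"
proof -
  let ?I = "LINT x:B|M. f x" and ?Q = "LINT x:B|M. (f x)\<^sup>2"
  have fi: "integrable M (\<lambda>x. indicator B x * f x)"
    and f2: "integrable M (\<lambda>x. indicator B x * (f x)\<^sup>2)"
    using integrable_real_mult_indicator[OF B square_integrable_integrable[OF f]]
      integrable_real_mult_indicator[OF B, of "\<lambda>x. (f x)\<^sup>2"] f
    by (simp_all add: square_integrable_def mult.commute)
  have iB: "integrable M (indicator B :: 'a \<Rightarrow> real)"
    using B by (intro integrable_real_indicator) (auto simp: less_top[symmetric])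
  have quad: "0 \<le> ?Q - 2 * t * ?I + t\<^sup>2 * measure M B" for t
  proof -
    have "0 \<le> (\<integral>x. indicator B x * (f x - t)\<^sup>2 \<partial>M)"
      by simp
    also have "\<dots> = (\<integral>x. indicator B x * (f x)\<^sup>2 - (2 * t) * (indicator B x * f x)
        + t\<^sup>2 * indicator B x \<partial>M)"
      by (intro Bochner_Integration.integral_cong) (auto simp: power2_eq_square algebra_simps)
    also have "\<dots> = ?Q - 2 * t * ?I + t\<^sup>2 * measure M B"
      using fi f2 iB B by (simp add: set_lebesgue_integral_def sets.Int_space_eq2)
    finally show ?thesis .
  qed
  show ?thesis
  proof (cases "measure M B = 0")
    case True
    have "?I = 0"
    proof (rule ccontr)
      assume "?I \<noteq> 0"
      \<comment> \<open>On a null set the polynomial is affine in \<open>t\<close>, and this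
        \<open>t\<close> gives it the value -1.\<close>
      with quad[of "(?Q + 1) / (2 * ?I)"] True show False
        by simp
    qed
    with True show ?thesis by simp
  next
    case False
    then have "measure M B > 0"
      by (simp add: zero_less_measure_iff)
    \<comment> \<open>This \<open>t\<close>, the mean of \<open>f\<close> over \<open>B\<close>,
      minimises the polynomial.\<close>
    with quad[of "?I / measure M B"] show ?thesis
      by (simp add: field_simps power2_eq_square)
  qed
qed

section \<open>Transition kernels under the invariant measure\<close>

context markov_process
begin

text \<open>Freezing the time coordinate of the progressively measurable map at the right endpoint
  \<open>t\<close> gives measurability for \<open>filt X t\<close>, hence for the larger
  \<open>sample X\<close>.\<close>

lemma measurable_traj:
  assumes "t \<ge> 0"
  shows "traj X t \<in> sample X \<rightarrow>\<^sub>M states X"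
proof -
  have space: "space (filt X t) = space (sample X)"
    using filtration_filt by (simp add: filtration_def)
  have "(\<lambda>\<omega>. (t, \<omega>)) \<in> filt X t \<rightarrow>\<^sub>M restrict_space borel {0..t} \<Otimes>\<^sub>M filt X t"
    using assms by (intro measurable_Pair measurable_const) (auto simp: space_restrict_space)
  from measurable_compose[OF this progressive[OF assms]]
  have "traj X t \<in> filt X t \<rightarrow>\<^sub>M states X"
    by simp
  then show ?thesis
    using measurable_mono[of "states X" "states X" "filt X t" "sample X"] sets_filt space by auto
qed

lemma transition_kernel:
  assumes "t \<ge> 0"
  shows "transition X t \<in> states X \<rightarrow>\<^sub>M prob_algebra (states X)"
  unfolding transition_def
  by (rule measurable_compose[OF law_kernel measurable_distr_prob_space[OF measurable_traj[OF assms]]])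

end

text \<open>By invariance, integrating the norm of \<open>g\<close> first against the kernel and
  then against \<mu> returns its finite \<mu>-integral, so the inner integral is finite almost
  everywhere. This keeps the Bochner integral away from its default value 0 for nonintegrable
  functions.\<close>

lemma (in markov_process) AE_integrable_transition:
  assumes inv: "invariant_probability X \<mu>" and t: "t \<ge> 0" and g: "integrable \<mu> g"
  shows "AE x in \<mu>. integrable (transition X t x) (g :: _ \<Rightarrow> real)"
proof -
  have sets: "sets \<mu> = sets (states X)" and bind: "\<mu> \<bind> transition X t = \<mu>"
    using inv t by (auto simp: invariant_probability_def)
  have kernel: "transition X t \<in> \<mu> \<rightarrow>\<^sub>M subprob_algebra (states X)"
    using measurable_prob_algebraD[OF transition_kernel[OF t]] measurable_cong_sets[OF sets refl]
    by blast
  have gm: "g \<in> borel_measurable (states X)"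
    using borel_measurable_integrable[OF g] measurable_cong_sets[OF sets refl] by blast
  have gm': "(\<lambda>y. ennreal (norm (g y))) \<in> borel_measurable (states X)"
    using gm by measurable
  have "(\<integral>\<^sup>+x. (\<integral>\<^sup>+y. ennreal (norm (g y)) \<partial>transition X t x) \<partial>\<mu>)
      = (\<integral>\<^sup>+y. ennreal (norm (g y)) \<partial>\<mu>)"
    using nn_integral_bind[OF gm' kernel] bind by simp
  also have "\<dots> \<noteq> \<infinity>"
    using g by (simp add: integrable_iff_bounded less_top[symmetric])
  finally have fin: "(\<integral>\<^sup>+x. (\<integral>\<^sup>+y. ennreal (norm (g y)) \<partial>transition X t x) \<partial>\<mu>) \<noteq> \<infinity>" .
  have "(\<lambda>x. \<integral>\<^sup>+y. ennreal (norm (g y)) \<partial>transition X t x) \<in> borel_measurable \<mu>"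
    by (rule measurable_compose[OF kernel nn_integral_measurable_subprob_algebra[OF gm']])
  from nn_integral_PInf_AE[OF this fin]
  show ?thesis
  proof (rule AE_mp, intro AE_I2 impI)
    fix x
    assume fin: "(\<integral>\<^sup>+y. ennreal (norm (g y)) \<partial>transition X t x) \<noteq> \<infinity>"
    have "g \<in> borel_measurable (transition X t x)"
      using gm by (simp add: transition_def)
    then show "integrable (transition X t x) g"
      using fin by (simp add: integrable_iff_bounded less_top)
  qed
qed

text \<open>The difference of the two sides is the variance of \<open>f\<close> under the transition
  law. The square is written as a product to match \<open>carre_du_champ\<close>.\<close>

lemma (in markov_process) AE_transition_square:
  assumes inv: "invariant_probability X \<mu>" and t: "t \<ge> 0"
    and f: "square_integrable \<mu> f"
  shows "AE x in \<mu>. (\<integral>y. f y \<partial>transition X t x)\<^sup>2 \<le> (\<integral>y. f y * f y \<partial>transition X t x)"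
proof -
  interpret \<mu>: prob_space \<mu>
    using inv by (simp add: invariant_probability_def)
  have space: "space \<mu> = space (states X)"
    using inv unfolding invariant_probability_def by (metis sets_eq_imp_space_eq)
  have "AE x in \<mu>. integrable (transition X t x) f"
    by (rule AE_integrable_transition[OF inv t \<mu>.square_integrable_integrable[OF f]])
  moreover have "AE x in \<mu>. integrable (transition X t x) (\<lambda>y. (f y)\<^sup>2)"
    using f by (intro AE_integrable_transition[OF inv t]) (simp add: square_integrable_def)
  ultimately show ?thesis
    using AE_space
  proof eventually_elim
    case (elim x)
    interpret P: prob_space "transition X t x"
      using measurable_space[OF transition_kernel[OF t]] elim(3) space
      by (auto simp: space_prob_algebra)
    show ?case
      using P.variance_eq[OF elim(1,2)] P.variance_positive[of f] by (simp add: power2_eq_square)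
  qed
qed

section \<open>Integrability and positivity of the carre du champ\<close>

context core_algebra
begin

lemma prob_space_invariant: "prob_space \<mu>"
  and sets_invariant: "sets \<mu> = sets (states X)"
  using invariant by (auto simp: invariant_probability_def)

lemma space_invariant: "space \<mu> = space (states X)"
  by (rule sets_eq_imp_space_eq[OF sets_invariant])

lemma square_integrable_core: "f \<in> A \<Longrightarrow> square_integrable \<mu> f"
  and square_integrable_generator: "f \<in> A \<Longrightarrow> square_integrable \<mu> (L f)"
  using in_L2_domain by (auto simp: L2_generator_def)

text \<open>Closure under products puts the square of \<open>f\<close> in \<open>A\<close>, so its
  generator is square integrable; the remaining terms are products of two square-integrable
  functions.\<close>

lemma integrable_carre_du_champ:
  assumes "f \<in> A"
  shows "integrable \<mu> (carre_du_champ L f f)"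
proof -
  interpret \<mu>: prob_space \<mu> by (rule prob_space_invariant)
  have "integrable \<mu> (L (\<lambda>y. f y * f y))"
    by (intro \<mu>.square_integrable_integrable square_integrable_generator mult_closed assms)
  moreover have "integrable \<mu> (\<lambda>x. f x * L f x)"
    by (intro square_integrable_mult_integrable square_integrable_core square_integrable_generator assms)
  ultimately show ?thesis
    unfolding carre_du_champ_def[abs_def] by (intro Bochner_Integration.integrable_diff)
qed

text \<open>
  Jensen's inequality gives \<open>(P\<^sub>t f\<^sup>2 - f\<^sup>2)/t \<ge> 2 f (P\<^sub>t f - f)/t\<close>, so the negative part of \<open>\<Gamma>(f)\<close> is
  dominated by the approximation errors \<open>\<bar>k\<bar> + 2 \<bar>f h\<bar>\<close> of the two difference quotients. Bounding
  this by \<open>\<delta> (1 + f\<^sup>2) + (k\<^sup>2 + h\<^sup>2)/\<delta>\<close> makes it accessible to the convergence in \<open>L\<^sup>2\<close>.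
\<close>

lemma carre_du_champ_nonneg:
  assumes f: "f \<in> A"
  shows "AE x in \<mu>. 0 \<le> carre_du_champ L f f x"
proof -
  interpret \<mu>: prob_space \<mu> by (rule prob_space_invariant)
  let ?G = "carre_du_champ L f f" and ?f2 = "\<lambda>y. f y * f y"
  define h where "h t x = ((\<integral>y. f y \<partial>transition X t x) - f x) / t - L f x" for t x
  define k where "k t x = ((\<integral>y. f y * f y \<partial>transition X t x) - f x * f x) / t - L ?f2 x" for t x
  \<comment> \<open>As \<open>ennreal\<close> sends negative reals to 0, \<open>N\<close> is the
    integral of the negative part of \<Gamma>(f); the goal becomes \<open>N = 0\<close>.\<close>
  define N where "N = (\<integral>\<^sup>+x. ennreal (- ?G x) \<partial>\<mu>)"
  define S where "S = 1 + (\<integral>x. (f x)\<^sup>2 \<partial>\<mu>)"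
  have f2: "?f2 \<in> A" using f f by (rule mult_closed)
  have fsq: "square_integrable \<mu> f" by (rule square_integrable_core[OF f])
  have f2int: "integrable \<mu> (\<lambda>x. (f x)\<^sup>2)" using fsq by (simp add: square_integrable_def)
  have S: "S \<ge> 0" unfolding S_def by simp
  have Gm: "?G \<in> borel_measurable \<mu>"
    using integrable_carre_du_champ[OF f] by (rule borel_measurable_integrable)
  have bound: "N \<le> ennreal (\<delta> * S) + ennreal (1 / \<delta>) * ((\<integral>\<^sup>+x. ennreal ((k t x)\<^sup>2) \<partial>\<mu>)
      + (\<integral>\<^sup>+x. ennreal ((h t x)\<^sup>2) \<partial>\<mu>))" if "\<delta> > 0" "t > 0" for \<delta> t
  proof -
    have kernel: "transition X t \<in> \<mu> \<rightarrow>\<^sub>M subprob_algebra (states X)"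
      using measurable_prob_algebraD[OF transition_kernel[of t]]
        measurable_cong_sets[OF sets_invariant refl] that(2) by (metis less_imp_le)
    have semigroup: "(\<lambda>x. \<integral>y. g y \<partial>transition X t x) \<in> borel_measurable \<mu>"
      if "g \<in> borel_measurable \<mu>" for g :: "_ \<Rightarrow> real"
      using that measurable_cong_sets[OF sets_invariant refl]
      by (intro measurable_compose[OF kernel integral_measurable_subprob_algebra]) blast
    have [measurable]: "f \<in> borel_measurable \<mu>" "?f2 \<in> borel_measurable \<mu>"
      "L f \<in> borel_measurable \<mu>" "L ?f2 \<in> borel_measurable \<mu>"
      using square_integrable_core[OF f] square_integrable_core[OF f2]
        square_integrable_generator[OF f] square_integrable_generator[OF f2]
      by (simp_all add: square_integrable_def)
    note [measurable] = semigroup[of f, simplified] semigroup[of ?f2, simplified]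
    have [measurable]: "h t \<in> borel_measurable \<mu>" "k t \<in> borel_measurable \<mu>"
      unfolding h_def k_def by measurable
    have pointwise: "AE x in \<mu>. - ?G x \<le> \<delta> * (1 + (f x)\<^sup>2) + (1 / \<delta>) * ((k t x)\<^sup>2 + (h t x)\<^sup>2)"
      using AE_transition_square[OF invariant less_imp_le[OF \<open>t > 0\<close>] fsq]
    proof eventually_elim
      case (elim x)
      let ?p = "\<integral>y. f y \<partial>transition X t x" and ?q = "\<integral>y. f y * f y \<partial>transition X t x"
      have "0 \<le> (?p - f x)\<^sup>2 / t"
        using \<open>t > 0\<close> by simp
      also have "\<dots> \<le> (?q - 2 * f x * ?p + (f x)\<^sup>2) / t"
        using elim \<open>t > 0\<close> by (intro divide_right_mono) (auto simp: power2_diff)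
      \<comment> \<open>Substituting the difference quotients by \<open>k\<close> and
        \<open>h\<close> cancels all terms of order 1/t and leaves \<Gamma>(f) plus errors.\<close>
      also have "\<dots> = ?G x + k t x - 2 * f x * h t x"
        using \<open>t > 0\<close> by (simp add: carre_du_champ_def k_def h_def field_simps power2_eq_square)
      finally have "- ?G x \<le> k t x + 2 * (- f x * h t x)"
        by simp
      moreover have young: "2 * u * v \<le> \<delta> * u\<^sup>2 + (1 / \<delta>) * v\<^sup>2" for u v
      proof -
        have "0 \<le> (\<delta> * u - v)\<^sup>2 / \<delta>" using \<open>\<delta> > 0\<close> by simp
        also have "\<dots> = \<delta> * u\<^sup>2 + (1 / \<delta>) * v\<^sup>2 - 2 * u * v"
          using \<open>\<delta> > 0\<close> by (simp add: field_simps power2_eq_square)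
        finally show ?thesis by simp
      qed
      \<comment> \<open>\<open>young\<close> bounds twice \<open>k t x\<close>; dropping the factor
        2 requires a sign, hence the case split.\<close>
      have "k t x \<le> \<delta> + (1 / \<delta>) * (k t x)\<^sup>2"
      proof (cases "k t x \<ge> 0")
        case True
        then show ?thesis using young[of 1 "k t x"] by simp
      next
        case False
        moreover have "0 \<le> (1 / \<delta>) * (k t x)\<^sup>2" using \<open>\<delta> > 0\<close> by simp
        ultimately show ?thesis using \<open>\<delta> > 0\<close> by linarith
      qed
      ultimately show ?case
        using young[of "- f x" "h t x"] by (simp add: algebra_simps)
    qed
    have "N \<le> (\<integral>\<^sup>+x. ennreal (\<delta> * (1 + (f x)\<^sup>2)) + ennreal (1 / \<delta>)
        * (ennreal ((k t x)\<^sup>2) + ennreal ((h t x)\<^sup>2)) \<partial>\<mu>)"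
      unfolding N_def
    proof (rule nn_integral_mono_AE, use pointwise in eventually_elim)
      case (elim x)
      have "ennreal (- ?G x) \<le> ennreal (\<delta> * (1 + (f x)\<^sup>2) + (1 / \<delta>) * ((k t x)\<^sup>2 + (h t x)\<^sup>2))"
        by (rule ennreal_leI[OF elim])
      also have "\<dots> = ennreal (\<delta> * (1 + (f x)\<^sup>2)) + ennreal (1 / \<delta>)
        * (ennreal ((k t x)\<^sup>2) + ennreal ((h t x)\<^sup>2))"
      proof -
        have "ennreal ((1 / \<delta>) * ((k t x)\<^sup>2 + (h t x)\<^sup>2))
          = ennreal (1 / \<delta>) * (ennreal ((k t x)\<^sup>2) + ennreal ((h t x)\<^sup>2))"
          using \<open>\<delta> > 0\<close> by (subst ennreal_mult) auto
        then show ?thesis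
          using \<open>\<delta> > 0\<close> by (subst ennreal_plus) auto
      qed
      finally show ?case .
    qed
    also have "\<dots> = (\<integral>\<^sup>+x. ennreal (\<delta> * (1 + (f x)\<^sup>2)) \<partial>\<mu>) + ennreal (1 / \<delta>)
        * ((\<integral>\<^sup>+x. ennreal ((k t x)\<^sup>2) \<partial>\<mu>) + (\<integral>\<^sup>+x. ennreal ((h t x)\<^sup>2) \<partial>\<mu>))"
      by (simp add: nn_integral_add nn_integral_cmult)
    also have "(\<integral>\<^sup>+x. ennreal (\<delta> * (1 + (f x)\<^sup>2)) \<partial>\<mu>) = ennreal (\<delta> * S)"
      using f2int \<open>\<delta> > 0\<close> unfolding S_def
      by (subst nn_integral_eq_integral) (auto simp: \<mu>.prob_space)
    finally show ?thesis .
  qed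
  have lim: "((\<lambda>t. \<integral>\<^sup>+x. ennreal ((h t x)\<^sup>2) \<partial>\<mu>) \<longlongrightarrow> 0) (at_right 0)"
    "((\<lambda>t. \<integral>\<^sup>+x. ennreal ((k t x)\<^sup>2) \<partial>\<mu>) \<longlongrightarrow> 0) (at_right 0)"
    using in_L2_domain[OF f] in_L2_domain[OF f2] by (simp_all add: L2_generator_def h_def k_def)
  \<comment> \<open>The order of limits matters: \<open>t\<close> tends to 0 while \<delta> is
    fixed, so the factor 1/\<delta> does no harm; only afterwards does \<delta> tend to 0.\<close>
  have N_small: "N \<le> ennreal (\<delta> * S)" if "\<delta> > 0" for \<delta>
  proof (rule tendsto_lowerbound)
    have "((\<lambda>t. ennreal (\<delta> * S) + ennreal (1 / \<delta>) * ((\<integral>\<^sup>+x. ennreal ((k t x)\<^sup>2) \<partial>\<mu>)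
      + (\<integral>\<^sup>+x. ennreal ((h t x)\<^sup>2) \<partial>\<mu>))) \<longlongrightarrow> ennreal (\<delta> * S) + ennreal (1 / \<delta>) * (0 + 0)) (at_right 0)"
      by (intro tendsto_intros lim ennreal_tendsto_cmult) auto
    then show "((\<lambda>t. ennreal (\<delta> * S) + ennreal (1 / \<delta>) * ((\<integral>\<^sup>+x. ennreal ((k t x)\<^sup>2) \<partial>\<mu>)
      + (\<integral>\<^sup>+x. ennreal ((h t x)\<^sup>2) \<partial>\<mu>))) \<longlongrightarrow> ennreal (\<delta> * S)) (at_right 0)"
      by simp
    show "\<forall>\<^sub>F t in at_right 0. N \<le> ennreal (\<delta> * S) + ennreal (1 / \<delta>)
      * ((\<integral>\<^sup>+x. ennreal ((k t x)\<^sup>2) \<partial>\<mu>) + (\<integral>\<^sup>+x. ennreal ((h t x)\<^sup>2) \<partial>\<mu>))"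
      using bound[OF that] by (auto simp: eventually_at_right_field intro: exI[of _ 1])
  qed simp
  have "N \<le> 0"
  proof (rule tendsto_lowerbound)
    have "((\<lambda>\<delta>. ennreal (\<delta> * S)) \<longlongrightarrow> ennreal (0 * S)) (at_right 0)"
      by (intro tendsto_intros)
    then show "((\<lambda>\<delta>. ennreal (\<delta> * S)) \<longlongrightarrow> 0) (at_right 0)"
      by simp
    show "\<forall>\<^sub>F \<delta> in at_right 0. N \<le> ennreal (\<delta> * S)"
      using N_small by (auto simp: eventually_at_right_field intro: exI[of _ 1])
  qed simp
  then have "(\<integral>\<^sup>+x. ennreal (- ?G x) \<partial>\<mu>) = 0"
    by (simp add: N_def)
  then have "AE x in \<mu>. ennreal (- ?G x) = 0"
    using Gm by (subst (asm) nn_integral_0_iff_AE) auto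
  then show ?thesis
    by eventually_elim (auto simp: ennreal_eq_0_iff)
qed

end

section \<open>Lyapunov-Poincare inequality with a general absorption constant\<close>

text \<open>The constant cancels in the increment of \<open>f\<close> along the trajectory.\<close>

lemma extended_generator_add_const:
  assumes "extended_generator X f g"
  shows "extended_generator X (\<lambda>x. f x + c) g"
  using assms by (auto simp: extended_generator_def)

text \<open>Treats both cases at once: \<beta> measures how much of \<open>V\<close> pays for
  \<open>b\<close> outside \<open>U\<close>, with \<beta> = b in case (1) and \<beta> = \<alpha> in
  case (2).\<close>

lemma (in core_algebra) lyapunov_poincare_add_const:
  fixes V LV :: "'e \<Rightarrow> real"
  assumes gen: "extended_generator X V LV"
    and V: "\<And>x. x \<in> space (states X) \<Longrightarrow> 1 \<le> V x"
    and drift: "\<And>x. x \<in> space (states X) \<Longrightarrow> LV x \<le> - \<alpha> * V x + b * indicator U x"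
    and U: "U \<in> sets (states X)" and U_pos: "0 < measure \<mu> U"
    and poincare: "local_poincare \<mu> L A U \<kappa>"
    and outside: "\<And>x. x \<in> space (states X) - U \<Longrightarrow> b \<le> \<beta> * V x"
    and pos: "0 < \<alpha>" "0 < b" "0 \<le> \<beta>" "0 \<le> c" "b * \<kappa> \<le> 1 + c"
    and small: "\<beta> * measure \<mu> (space (states X) - U) < \<alpha> * measure \<mu> U"
  shows "\<exists>K>0. 1 / K = \<alpha> / (1 + c)
      * (1 - \<beta> * measure \<mu> (space (states X) - U) / (\<alpha> * measure \<mu> U))
    \<and> lyapunov_poincare X \<mu> L A (\<lambda>x. V x + c) LV K"
proof -
  interpret \<mu>: prob_space \<mu> by (rule prob_space_invariant)
  define Uc where "Uc = space (states X) - U"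
  \<comment> \<open>\<theta> is the coefficient of the integral of
    \<open>V x * (f x)\<^sup>2\<close> that survives the absorption. The factor \<open>1 + c\<close>
    in \<open>K\<close> comes from \<open>V x + c \<le> (1 + c) * V x\<close>, valid as
    \<open>1 \<le> V x\<close>.\<close>
  define \<theta> where "\<theta> = \<alpha> - \<beta> * measure \<mu> Uc / measure \<mu> U"
  define K where "K = (1 + c) / \<theta>"
  have \<theta>: "0 < \<theta>"
    using small U_pos by (simp add: \<theta>_def Uc_def field_simps)
  have K: "0 < K" using \<theta> pos by (simp add: K_def)
  have inv_K: "1 / K = \<alpha> / (1 + c) * (1 - \<beta> * measure \<mu> Uc / (\<alpha> * measure \<mu> U))"
  proof -
    have "\<alpha> * (1 - \<beta> * measure \<mu> Uc / (\<alpha> * measure \<mu> U)) = \<theta>"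
      using pos U_pos by (simp add: \<theta>_def right_diff_distrib)
    then show ?thesis by (simp add: K_def)
  qed
  have sU: "U \<in> sets \<mu>" and sUc: "Uc \<in> sets \<mu>"
    using U sets_invariant by (auto simp: Uc_def)
  have [measurable]: "V \<in> borel_measurable \<mu>"
    using gen measurable_cong_sets[OF sets_invariant refl] by (auto simp: extended_generator_def)
  have "integrable \<mu> (\<lambda>x. (f x)\<^sup>2 * (V x + c)) \<and>
      (\<integral>x. (f x)\<^sup>2 * (V x + c) \<partial>\<mu>)
        \<le> K * (\<integral>x. (V x + c) * carre_du_champ L f f x - (f x)\<^sup>2 * LV x \<partial>\<mu>)"
    if f: "f \<in> A" and mean: "(\<integral>x. f x \<partial>\<mu>) = 0"
      and R: "integrable \<mu> (\<lambda>x. (V x + c) * carre_du_champ L f f x - (f x)\<^sup>2 * LV x)" for f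
  proof -
    let ?G = "carre_du_champ L f f"
    let ?R = "\<lambda>x. (V x + c) * ?G x - (f x)\<^sup>2 * LV x"
    have fsq: "square_integrable \<mu> f" by (rule square_integrable_core[OF f])
    have [measurable]: "f \<in> borel_measurable \<mu>" and f2: "integrable \<mu> (\<lambda>x. (f x)\<^sup>2)"
      using fsq by (auto simp: square_integrable_def)
    have f1: "integrable \<mu> f" by (rule \<mu>.square_integrable_integrable[OF fsq])
    have G: "integrable \<mu> ?G" by (rule integrable_carre_du_champ[OF f])
    have f2U: "integrable \<mu> (\<lambda>x. indicator U x * (f x)\<^sup>2)"
      and f2Uc: "integrable \<mu> (\<lambda>x. indicator Uc x * (f x)\<^sup>2)"
      and f1U: "integrable \<mu> (\<lambda>x. indicator U x * f x)"
      and f1Uc: "integrable \<mu> (\<lambda>x. indicator Uc x * f x)"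
      using integrable_real_mult_indicator[OF sU f2] integrable_real_mult_indicator[OF sUc f2]
        integrable_real_mult_indicator[OF sU f1] integrable_real_mult_indicator[OF sUc f1]
      by (simp_all add: mult.commute)
    have R_ge: "AE x in \<mu>. (1 + c) * ?G x + \<alpha> * (V x * (f x)\<^sup>2) - b * (indicator U x * (f x)\<^sup>2) \<le> ?R x"
      using carre_du_champ_nonneg[OF f] AE_space
    proof eventually_elim
      case (elim x)
      then have x: "x \<in> space (states X)" by (simp add: space_invariant)
      have "(1 + c) * ?G x \<le> (V x + c) * ?G x"
        using V[OF x] elim(1) by (intro mult_right_mono) auto
      moreover have "(f x)\<^sup>2 * LV x \<le> (f x)\<^sup>2 * (- \<alpha> * V x + b * indicator U x)"
        by (intro mult_left_mono drift[OF x]) simp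
      ultimately show ?case by (simp add: algebra_simps)
    qed
    \<comment> \<open>Deduced from the integrability of \<open>?R\<close>: dropping the nonnegative
      energy term in \<open>R_ge\<close> leaves an integrable upper bound.\<close>
    have V1: "integrable \<mu> (\<lambda>x. V x * (f x)\<^sup>2)"
    proof (rule Bochner_Integration.integrable_bound)
      show "integrable \<mu> (\<lambda>x. (?R x + b * (indicator U x * (f x)\<^sup>2)) / \<alpha>)"
        using R f2U by (intro integrable_divide Bochner_Integration.integrable_add) auto
      show "AE x in \<mu>. norm (V x * (f x)\<^sup>2) \<le> norm ((?R x + b * (indicator U x * (f x)\<^sup>2)) / \<alpha>)"
        using R_ge carre_du_champ_nonneg[OF f] AE_space
      proof eventually_elim
        case (elim x)
        then have "0 \<le> V x * (f x)\<^sup>2" using V[of x] by (simp add: space_invariant)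
        moreover have "0 \<le> (1 + c) * ?G x" using elim pos by simp
        then have "V x * (f x)\<^sup>2 \<le> (?R x + b * (indicator U x * (f x)\<^sup>2)) / \<alpha>"
          using elim(1) pos(1) by (simp add: pos_le_divide_eq mult.commute[of _ \<alpha>])
        ultimately show ?case unfolding real_norm_def by linarith
      qed
    qed simp
    define v where "v = (\<integral>x. V x * (f x)\<^sup>2 \<partial>\<mu>)"
    define g where "g = (\<integral>x. ?G x \<partial>\<mu>)"
    define q where "q = (LINT x:U|\<mu>. (f x)\<^sup>2)"
    define p where "p = (LINT x:Uc|\<mu>. (f x)\<^sup>2)"
    have R_int: "(1 + c) * g + \<alpha> * v - b * q \<le> (\<integral>x. ?R x \<partial>\<mu>)"
    proof -
      have "(1 + c) * g + \<alpha> * v - b * q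
        = (\<integral>x. (1 + c) * ?G x + \<alpha> * (V x * (f x)\<^sup>2) - b * (indicator U x * (f x)\<^sup>2) \<partial>\<mu>)"
        using G V1 f2U by (simp add: g_def v_def q_def set_lebesgue_integral_def)
      also have "\<dots> \<le> (\<integral>x. ?R x \<partial>\<mu>)"
        using G V1 f2U R R_ge by (intro integral_mono_AE) auto
      finally show ?thesis .
    qed
    have "(LINT x:U|\<mu>. f x) + (LINT x:Uc|\<mu>. f x)
        = (\<integral>x. indicator U x * f x + indicator Uc x * f x \<partial>\<mu>)"
      using f1U f1Uc by (simp add: set_lebesgue_integral_def)
    also have "\<dots> = (\<integral>x. f x \<partial>\<mu>)"
      by (intro Bochner_Integration.integral_cong)
        (auto simp: Uc_def space_invariant indicator_def)
    finally have "(LINT x:U|\<mu>. f x) = - (LINT x:Uc|\<mu>. f x)"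
      using mean by simp
    then have "(LINT x:U|\<mu>. f x)\<^sup>2 \<le> measure \<mu> Uc * p"
      using \<mu>.set_integral_Cauchy_Schwarz[OF fsq sUc] by (simp add: p_def)
    then have "1 / measure \<mu> U * (LINT x:U|\<mu>. f x)\<^sup>2 \<le> 1 / measure \<mu> U * (measure \<mu> Uc * p)"
      by (intro mult_left_mono) auto
    then have "q \<le> \<kappa> * g + 1 / measure \<mu> U * (measure \<mu> Uc * p)"
      using poincare f mean unfolding local_poincare_def q_def g_def by fastforce
    then have "b * q \<le> b * (\<kappa> * g + 1 / measure \<mu> U * (measure \<mu> Uc * p))"
      using pos by (intro mult_left_mono) auto
    also have "\<dots> = (b * \<kappa>) * g + measure \<mu> Uc / measure \<mu> U * (b * p)"
      by (simp add: algebra_simps)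
    finally have bq: "b * q \<le> (b * \<kappa>) * g + measure \<mu> Uc / measure \<mu> U * (b * p)" .
    have energy: "(b * \<kappa>) * g \<le> (1 + c) * g"
      using pos carre_du_champ_nonneg[OF f]
      by (intro mult_right_mono) (auto simp: g_def intro: integral_nonneg_AE)
    \<comment> \<open>Outside \<open>U\<close> this is \<open>outside\<close>; on \<open>U\<close>
      the left integrand vanishes and the right one is nonnegative.\<close>
    have "b * p \<le> \<beta> * v"
    proof -
      have "b * p = (\<integral>x. b * (indicator Uc x * (f x)\<^sup>2) \<partial>\<mu>)"
        by (simp add: p_def set_lebesgue_integral_def)
      also have "\<dots> \<le> (\<integral>x. \<beta> * (V x * (f x)\<^sup>2) \<partial>\<mu>)"
      proof (rule integral_mono)
        fix x
        assume "x \<in> space \<mu>"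
        then have x: "x \<in> space (states X)" by (simp add: space_invariant)
        show "b * (indicator Uc x * (f x)\<^sup>2) \<le> \<beta> * (V x * (f x)\<^sup>2)"
        proof (cases "x \<in> U")
          case True
          then show ?thesis using V[OF x] pos(3) by (simp add: Uc_def)
        next
          case False
          then have "b * (f x)\<^sup>2 \<le> \<beta> * V x * (f x)\<^sup>2"
            using outside[of x] x by (intro mult_right_mono) auto
          then show ?thesis using False x by (simp add: Uc_def mult.assoc)
        qed
      qed (use V1 f2Uc in auto)
      also have "\<dots> = \<beta> * v" by (simp add: v_def)
      finally show ?thesis .
    qed
    then have "measure \<mu> Uc / measure \<mu> U * (b * p) \<le> measure \<mu> Uc / measure \<mu> U * (\<beta> * v)"
      by (intro mult_left_mono) auto
    with bq energy have "b * q \<le> (1 + c) * g + measure \<mu> Uc / measure \<mu> U * (\<beta> * v)"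
      by linarith
    then have main: "\<theta> * v \<le> (\<integral>x. ?R x \<partial>\<mu>)"
      using R_int by (simp add: \<theta>_def algebra_simps)
    have W: "integrable \<mu> (\<lambda>x. (f x)\<^sup>2 * (V x + c))"
      using Bochner_Integration.integrable_add[OF V1 integrable_mult_right[OF f2, of c]]
      by (simp add: algebra_simps)
    have "(\<integral>x. (f x)\<^sup>2 * (V x + c) \<partial>\<mu>) \<le> (\<integral>x. (1 + c) * (V x * (f x)\<^sup>2) \<partial>\<mu>)"
    proof (rule integral_mono[OF W])
      fix x
      assume "x \<in> space \<mu>"
      then have "1 \<le> V x" using V by (simp add: space_invariant)
      then have "c * 1 \<le> c * V x" using pos by (intro mult_left_mono) auto
      then have "V x + c \<le> (1 + c) * V x" by (simp add: algebra_simps)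
      then have "(f x)\<^sup>2 * (V x + c) \<le> (f x)\<^sup>2 * ((1 + c) * V x)" by (rule mult_left_mono) simp
      then show "(f x)\<^sup>2 * (V x + c) \<le> (1 + c) * (V x * (f x)\<^sup>2)" by (simp add: algebra_simps)
    qed (use V1 in simp)
    also have "\<dots> = K * (\<theta> * v)"
      using \<theta> by (simp add: v_def K_def)
    also have "\<dots> \<le> K * (\<integral>x. ?R x \<partial>\<mu>)"
      using K main by simp
    finally show ?thesis using W by simp
  qed
  then have "lyapunov_poincare X \<mu> L A (\<lambda>x. V x + c) LV K"
    using extended_generator_add_const[OF gen] by (simp add: lyapunov_poincare_def)
  then show ?thesis
    using K inv_K unfolding Uc_def by blast
qed

section \<open>Choice of the constants in the two cases\<close>

theorem theorem3p6:
  fixes X :: "('e, 'w) process"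
    and \<mu> :: "'e measure"
    and L :: "('e \<Rightarrow> real) \<Rightarrow> 'e \<Rightarrow> real"
    and A :: "('e \<Rightarrow> real) set"
    and V LV :: "'e \<Rightarrow> real"
    and \<alpha> b \<kappa> :: real
    and C U :: "'e set"
  assumes "core_algebra X \<mu> L A"
    and "extended_generator X V LV"
    and "\<forall>x\<in>space (states X). 1 \<le> V x"
    and "integrable \<mu> V"
    and "\<alpha> > 0" and "b > 0" and "C \<subseteq> space (states X)"
    and "\<forall>x\<in>space (states X). LV x \<le> - 2 * \<alpha> * V x + b * indicator C x"
    and "U \<in> sets (states X)"
    and "local_poincare \<mu> L A U \<kappa>"
    and "(C \<inter> {x \<in> space (states X). V x \<le> b / \<alpha>} \<subseteq> U
            \<and> \<alpha> * measure \<mu> U > b * measure \<mu> (space (states X) - U))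
       \<or> ({x \<in> space (states X). V x \<le> b / \<alpha>} \<subseteq> U
            \<and> measure \<mu> U > measure \<mu> (space (states X) - U))"
  shows "(\<exists>c\<ge>0. \<exists>K>0. lyapunov_poincare X \<mu> L A (\<lambda>x. V x + c) LV K)
    \<and> (C \<inter> {x \<in> space (states X). V x \<le> b / \<alpha>} \<subseteq> U
          \<and> \<alpha> * measure \<mu> U > b * measure \<mu> (space (states X) - U)
        \<longrightarrow> (let c = max (b * \<kappa> - 1) 0 in
              \<exists>K>0. 1 / K = \<alpha> / (1 + c)
                        * (1 - b * measure \<mu> (space (states X) - U) / (\<alpha> * measure \<mu> U))
                \<and> lyapunov_poincare X \<mu> L A (\<lambda>x. V x + c) LV K))
    \<and> ({x \<in> space (states X). V x \<le> b / \<alpha>} \<subseteq> U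
          \<and> measure \<mu> U > measure \<mu> (space (states X) - U)
        \<longrightarrow> (let c = max (b * \<kappa> - 1) 0 in
              \<exists>K>0. 1 / K = \<alpha> / (1 + c)
                        * (1 - measure \<mu> (space (states X) - U) / measure \<mu> U)
                \<and> lyapunov_poincare X \<mu> L A (\<lambda>x. V x + c) LV K))"
proof -
  interpret core_algebra X \<mu> L A by fact
  let ?Uc = "space (states X) - U"
  let ?c = "max (b * \<kappa> - 1) 0"
  let ?case1 = "C \<inter> {x \<in> space (states X). V x \<le> b / \<alpha>} \<subseteq> U
      \<and> \<alpha> * measure \<mu> U > b * measure \<mu> ?Uc"
  let ?case2 = "{x \<in> space (states X). V x \<le> b / \<alpha>} \<subseteq> U
      \<and> measure \<mu> U > measure \<mu> ?Uc"
  note pos [simp] = \<open>\<alpha> > 0\<close> \<open>b > 0\<close>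
  note nonneg [simp] = pos[THEN less_imp_le]
  have V: "1 \<le> V x" if "x \<in> space (states X)" for x
    using assms(3) that by blast
  \<comment> \<open>The inclusion of case (2) implies that of case (1), so this single drift bound
    serves both.\<close>
  have drift: "LV x \<le> - \<alpha> * V x + b * indicator U x"
    if sub: "C \<inter> {x \<in> space (states X). V x \<le> b / \<alpha>} \<subseteq> U" and x: "x \<in> space (states X)" for x
  proof -
    have LV: "LV x \<le> - 2 * \<alpha> * V x + b * indicator C x"
      using assms(8) x by blast
    have V_pos: "0 < \<alpha> * V x" using V[OF x] by simp
    show ?thesis
    proof (cases "x \<in> C \<and> x \<notin> U")
      case True
      then have "b / \<alpha> < V x" using sub x by force
      then have "b < \<alpha> * V x" by (simp add: pos_divide_less_eq mult.commute)
      with LV True show ?thesis by simp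
    next
      case False
      then have "b * indicator C x \<le> b * indicator U x"
        by (auto simp: indicator_def)
      then show ?thesis using LV V_pos by linarith
    qed
  qed
  \<comment> \<open>\<open>?c\<close> is the least nonnegative constant with the second property,
    which lets the energy term be absorbed.\<close>
  have c: "0 \<le> ?c" "b * \<kappa> \<le> 1 + ?c" by auto
  have first: "\<exists>K>0. 1 / K = \<alpha> / (1 + ?c) * (1 - b * measure \<mu> ?Uc / (\<alpha> * measure \<mu> U))
      \<and> lyapunov_poincare X \<mu> L A (\<lambda>x. V x + ?c) LV K" if h: ?case1
  proof (rule lyapunov_poincare_add_const[OF assms(2) V drift _ _ assms(10)])
    \<comment> \<open>Positivity of \<mu>(U) comes from the strict inequality of the case, whose
      smaller side is nonnegative.\<close>
    have "0 \<le> b * measure \<mu> ?Uc" by (intro mult_nonneg_nonneg) auto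
    then have "0 < \<alpha> * measure \<mu> U" using h by linarith
    then show "0 < measure \<mu> U" by (simp add: zero_less_mult_iff)
    show "b \<le> b * V x" if "x \<in> ?Uc" for x
      using V[of x] that by simp
  qed (use h c assms(9) in auto)
  have second: "\<exists>K>0. 1 / K = \<alpha> / (1 + ?c) * (1 - measure \<mu> ?Uc / measure \<mu> U)
      \<and> lyapunov_poincare X \<mu> L A (\<lambda>x. V x + ?c) LV K" if h: ?case2
  proof -
    \<comment> \<open>Here \<beta> = \<alpha>, since \<open>V\<close> exceeds b/\<alpha> outside
      \<open>U\<close>; the common factor \<alpha> is kept to fit the general lemma and cancelled at
      the end.\<close>
    have "\<exists>K>0. 1 / K = \<alpha> / (1 + ?c) * (1 - \<alpha> * measure \<mu> ?Uc / (\<alpha> * measure \<mu> U))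
      \<and> lyapunov_poincare X \<mu> L A (\<lambda>x. V x + ?c) LV K"
    proof (rule lyapunov_poincare_add_const[OF assms(2) V drift _ _ assms(10)])
      show "0 < measure \<mu> U" using h measure_nonneg[of \<mu> ?Uc] by linarith
      show "b \<le> \<alpha> * V x" if "x \<in> ?Uc" for x
      proof -
        have "b / \<alpha> < V x" using h that by force
        then show ?thesis by (simp add: pos_divide_less_eq mult.commute)
      qed
    qed (use h c assms(9) in auto)
    then show ?thesis using \<open>\<alpha> > 0\<close> by (simp add: mult_divide_mult_cancel_left)
  qed
  have "\<exists>c\<ge>0. \<exists>K>0. lyapunov_poincare X \<mu> L A (\<lambda>x. V x + c) LV K"
    using assms(11) first second c(1) by blast
  then show ?thesis
    using first second unfolding Let_def by blast
qed

end
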